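(* Let $\Phi$ be a finite irreducible crystallographic root system with associated affine root system $\widetilde\Phi$, and let $H$ be any hemispace of the oriented matroid $(\widetilde\Phi,-,cx)$ where $cx:=\mathrm{cone}_{\widetilde\Phi}$. Let $H_1,H_2$ be two hemispaces in a same block with $H_1\le H_2$ in the tope poset based at $H$. Then the interval $[H_1,H_2]$ of the tope poset based at $H$ is a lattice.
   Context: Affine root system: $\Phi$ lies in a Euclidean space $V$, with positive system $\Phi^+$ and $\Phi^-=-\Phi^+$. Put $V'=V\oplus\mathbb R\delta$. For $\alpha\in\Phi^+$ let $\{\alpha\}^\wedge=\{\alpha+n\delta\mid n\in\mathbb Z_{\ge0}\}$; for $\alpha\in\Phi^-$ let $\{\alpha\}^\wedge=\{\alpha+(n+1)\delta\mid n\in\mathbb Z_{\ge0}\}$; for $\Lambda\subset\Phi$ let $\Lambda^\wedge=\bigcup_{\alpha\in\Lambda}\{\alpha\}^\wedge$. The affine root system is $\widetilde\Phi=\Phi^\wedge\uplus-\Phi^\wedge\subset V'$. For $\Gamma\subset\widetilde\Phi$, $\mathrm{cone}(\Gamma)$ is the set of all finite sums $\sum k_iv_i$ with $v_i\in\Gamma\cup\{0\}$, $k_i\in\mathbb R_{\ge0}$, and $\mathrm{cone}_{\widetilde\Phi}(\Gamma)=\mathrm{cone}(\Gamma)\cap\widetilde\Phi$. The triple $(\widetilde\Phi,-,\mathrm{cone}_{\widetilde\Phi})$ is a (possibly infinite) oriented matroid with involution $x\mapsto-x$ and closure operator $\mathrm{cone}_{\widetilde\Phi}$. A subset is convex if it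 is closed under this closure operator. A hemispace (tope) is a convex set $F\subset\widetilde\Phi$ with $F\cap-F=\emptyset$ and $F\cup-F=\widetilde\Phi$. The tope poset based at a hemispace $H$ is the set of all hemispaces ordered by $F\le G\iff F\,\triangle\,H\subset G\,\triangle\,H$, where $\triangle$ is symmetric difference. Two hemispaces are in the same block if their symmetric difference is finite. *)

theory Defs
  imports "HOL-Analysis.Analysis" "HOL-Algebra.Lattice"
begin

section \<open>Finite root systems\<close>

definition root_reflection :: "'a::euclidean_space \<Rightarrow> 'a \<Rightarrow> 'a" where
  "root_reflection \<alpha> v = v - (2 * (v \<bullet> \<alpha>) / (\<alpha> \<bullet> \<alpha>)) *\<^sub>R \<alpha>"

text \<open>Root systems are reduced. They are not required to span the ambient space; the
  requirement that they do would be an additional hypothesis.\<close>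

definition finite_root_system :: "'a::euclidean_space set \<Rightarrow> bool" where
  "finite_root_system \<Phi> \<longleftrightarrow>
     finite \<Phi> \<and> 0 \<notin> \<Phi> \<and>
     (\<forall>\<alpha>\<in>\<Phi>. \<Phi> \<inter> span {\<alpha>} = {\<alpha>, - \<alpha>}) \<and>
     (\<forall>\<alpha>\<in>\<Phi>. root_reflection \<alpha> ` \<Phi> = \<Phi>)"

definition crystallographic :: "'a::euclidean_space set \<Rightarrow> bool" where
  "crystallographic \<Phi> \<longleftrightarrow> (\<forall>\<alpha>\<in>\<Phi>. \<forall>\<beta>\<in>\<Phi>. 2 * (\<beta> \<bullet> \<alpha>) / (\<alpha> \<bullet> \<alpha>) \<in> \<int>)"

definition irreducible_roots :: "'a::euclidean_space set \<Rightarrow> bool" where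
  "irreducible_roots \<Phi> \<longleftrightarrow>
     \<Phi> \<noteq> {} \<and>
     \<not> (\<exists>A B. A \<noteq> {} \<and> B \<noteq> {} \<and> A \<inter> B = {} \<and> A \<union> B = \<Phi> \<and>
            (\<forall>\<alpha>\<in>A. \<forall>\<beta>\<in>B. \<alpha> \<bullet> \<beta> = 0))"

text \<open>A positive system is cut out by a vector lying on no root hyperplane, i.e. by a point of
  an open Weyl chamber.\<close>

definition positive_system :: "'a::euclidean_space set \<Rightarrow> 'a set \<Rightarrow> bool" where
  "positive_system \<Phi> P \<longleftrightarrow>
     (\<exists>\<rho>. (\<forall>\<alpha>\<in>\<Phi>. \<rho> \<bullet> \<alpha> \<noteq> 0) \<and> P = {\<alpha> \<in> \<Phi>. \<rho> \<bullet> \<alpha> > 0})"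


section \<open>The affine root system\<close>

text \<open>The space \<open>V \<oplus> \<real>\<delta>\<close> is the product type \<^typ>\<open>'a \<times> real\<close>: the pair \<open>(v, c)\<close>
  stands for \<open>v + c\<delta>\<close>. Below, \<open>P\<close> is the positive system and \<open>uminus ` P\<close> the set
  of negative roots.\<close>

definition affine_hat :: "'a::euclidean_space set \<Rightarrow> 'a set \<Rightarrow> ('a \<times> real) set" where
  "affine_hat P \<Lambda> =
     {(\<alpha>, real n) | \<alpha> n. \<alpha> \<in> \<Lambda> \<and> \<alpha> \<in> P} \<union>
     {(\<alpha>, real (n + 1)) | \<alpha> n. \<alpha> \<in> \<Lambda> \<and> \<alpha> \<in> uminus ` P}"

definition affine_roots :: "'a::euclidean_space set \<Rightarrow> 'a set \<Rightarrow> ('a \<times> real) set" where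
  "affine_roots \<Phi> P = affine_hat P \<Phi> \<union> uminus ` affine_hat P \<Phi>"

definition root_cone :: "'v::real_vector set \<Rightarrow> 'v set" where
  "root_cone \<Gamma> =
     {\<Sum>i<m. k i *\<^sub>R v i | (m::nat) (k :: nat \<Rightarrow> real) v. \<forall>i<m. v i \<in> \<Gamma> \<union> {0} \<and> k i \<ge> 0}"

definition cone_in :: "'v::real_vector set \<Rightarrow> 'v set \<Rightarrow> 'v set" where
  "cone_in E \<Gamma> = root_cone \<Gamma> \<inter> E"


section \<open>Hemispaces and the tope poset\<close>

text \<open>The triple (ground set \<open>E\<close>, involution \<open>iv\<close>, closure operator \<open>cx\<close>) is an
  oriented matroid in the applications; the definitions use only the data.\<close>

definition om_convex :: "'v set \<Rightarrow> ('v set \<Rightarrow> 'v set) \<Rightarrow> 'v set \<Rightarrow> bool" where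
  "om_convex E cx F \<longleftrightarrow> F \<subseteq> E \<and> cx F = F"

definition hemispace :: "'v set \<Rightarrow> ('v \<Rightarrow> 'v) \<Rightarrow> ('v set \<Rightarrow> 'v set) \<Rightarrow> 'v set \<Rightarrow> bool" where
  "hemispace E iv cx F \<longleftrightarrow> om_convex E cx F \<and> F \<inter> iv ` F = {} \<and> F \<union> iv ` F = E"

definition tope_poset ::
  "'v set \<Rightarrow> ('v \<Rightarrow> 'v) \<Rightarrow> ('v set \<Rightarrow> 'v set) \<Rightarrow> 'v set \<Rightarrow> 'v set gorder" where
  "tope_poset E iv cx H =
     \<lparr>carrier = {F. hemispace E iv cx F}, eq = (=),
      le = (\<lambda>F G. sym_diff F H \<subseteq> sym_diff G H)\<rparr>"

definition same_block :: "'v set \<Rightarrow> 'v set \<Rightarrow> bool" where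
  "same_block F G \<longleftrightarrow> finite (sym_diff F G)"

definition poset_interval :: "('p, 'q) gorder_scheme \<Rightarrow> 'p \<Rightarrow> 'p \<Rightarrow> ('p, 'q) gorder_scheme" where
  "poset_interval L a b = L\<lparr>carrier := at_least_at_most L a b\<rparr>"

end

(* The affine root system is the product of Phi with the integers, and it is stable under the linear
   reflections s_(alpha,n). Call a root of a hemispace F a wall if it is not a nonnegative
   combination of the other roots of F. Reversing a wall yields again a hemispace, which is the
   image of F under the corresponding reflection, and if F - G is finite and nonempty it contains
   a wall of F. If two walls a, b of F are both reversed in some G with F - G finite, then
   alternating reflections produce the hemispace that differs from F exactly in the roots of
   cone(a, b), and this is the join of the two covers of F. A finite-length poset in which any
   two covers of an element have a join has all joins; meets follow by exchanging the two ends
   of the interval. *)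
theory Submission
  imports Defs
begin

section \<open>Finitely generated convex cones\<close>

lemma sum_in_convex_cone:
  assumes "convex_cone T" "\<And>i. i \<in> A \<Longrightarrow> f i \<in> T"
  shows "sum f A \<in> T"
  using assms(2)
  by (induction A rule: infinite_finite_induct)
     (auto simp: convex_cone_contains_0[OF assms(1)] intro: convex_cone_add[OF assms(1)])

text \<open>The finite sums form a convex cone, and every convex cone containing \<open>S\<close>
  contains them. This makes monotonicity and linear images of hulls available for
  \<open>root_cone\<close>.\<close>

lemma root_cone_eq_hull: "root_cone S = convex_cone hull S"
proof (rule hull_unique[symmetric])
  show "S \<subseteq> root_cone S"
  proof
    fix x assume "x \<in> S"
    then show "x \<in> root_cone S"
      unfolding root_cone_def
      by (intro CollectI exI[of _ "Suc 0"] exI[of _ "\<lambda>_. 1"] exI[of _ "\<lambda>_. x"]) simp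
  qed
  have "0 \<in> root_cone S"
    unfolding root_cone_def by (rule CollectI, rule exI[of _ 0]) simp
  moreover have "x + y \<in> root_cone S" if "x \<in> root_cone S" "y \<in> root_cone S" for x y
  proof -
    from that obtain m n :: nat and k l v w where
      x: "x = (\<Sum>i<m. k i *\<^sub>R v i)" "\<forall>i<m. v i \<in> S \<union> {0} \<and> k i \<ge> (0::real)" and
      y: "y = (\<Sum>i<n. l i *\<^sub>R w i)" "\<forall>i<n. w i \<in> S \<union> {0} \<and> l i \<ge> (0::real)"
      unfolding root_cone_def by blast
    \<comment> \<open>Concatenation of the two families, the second one shifted by
      \<open>m\<close>.\<close>
    define k' where "k' i = (if i < m then k i else l (i - m))" for i
    define v' where "v' i = (if i < m then v i else w (i - m))" for i
    have "(\<Sum>i<m + n. k' i *\<^sub>R v' i) = (\<Sum>i<m. k' i *\<^sub>R v' i) + (\<Sum>i<n. k' (m + i) *\<^sub>R v' (m + i))"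
      by (induction n) (simp_all add: add.assoc)
    also have "\<dots> = x + y"
      by (simp add: x(1) y(1) k'_def v'_def)
    finally have "x + y = (\<Sum>i<m + n. k' i *\<^sub>R v' i)" ..
    moreover have "\<forall>i<m + n. v' i \<in> S \<union> {0} \<and> k' i \<ge> 0"
      using x(2) y(2) by (auto simp: k'_def v'_def)
    ultimately show ?thesis
      unfolding root_cone_def by blast
  qed
  moreover have "c *\<^sub>R x \<in> root_cone S" if "x \<in> root_cone S" "c \<ge> 0" for c x
  proof -
    from that obtain m :: nat and k v where
      x: "x = (\<Sum>i<m. k i *\<^sub>R v i)" "\<forall>i<m. v i \<in> S \<union> {0} \<and> k i \<ge> (0::real)"
      unfolding root_cone_def by blast
    have "c *\<^sub>R x = (\<Sum>i<m. (c * k i) *\<^sub>R v i)"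
      by (simp add: x(1) scaleR_sum_right)
    moreover have "\<forall>i<m. v i \<in> S \<union> {0} \<and> c * k i \<ge> 0"
      using x(2) that(2) by simp
    ultimately show ?thesis
      unfolding root_cone_def by (intro CollectI exI[of _ m] exI[of _ "\<lambda>i. c * k i"] exI[of _ v] conjI)
  qed
  ultimately show "convex_cone (root_cone S)"
    by (auto simp: convex_cone_iff)
  show "root_cone S \<subseteq> T" if "S \<subseteq> T" "convex_cone T" for T
  proof
    fix x assume "x \<in> root_cone S"
    then obtain m :: nat and k v where
      x: "x = (\<Sum>i<m. k i *\<^sub>R v i)" "\<forall>i<m. v i \<in> S \<union> {0} \<and> k i \<ge> (0::real)"
      unfolding root_cone_def by blast
    have "\<forall>i<m. k i *\<^sub>R v i \<in> T"
      using x(2) that convex_cone_contains_0[OF that(2)]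
      by (auto intro!: convex_cone_scaleR[OF that(2)])
    then have "(\<Sum>i<m. k i *\<^sub>R v i) \<in> T"
      by (intro sum_in_convex_cone that) auto
    with x(1) show "x \<in> T" by simp
  qed
qed

text \<open>The vectors of the form on the right are themselves a convex cone containing
  \<open>a\<close> and \<open>S\<close>, so minimality of the hull applies. The lemma isolates the
  coefficient of one generator.\<close>

lemma convex_cone_hull_insert_decompose:
  "x \<in> convex_cone hull (insert a S) \<longleftrightarrow> (\<exists>t\<ge>0. \<exists>y\<in>convex_cone hull S. x = t *\<^sub>R a + y)"
proof
  assume "x \<in> convex_cone hull (insert a S)"
  moreover have "convex_cone hull (insert a S) \<subseteq> {x. \<exists>t\<ge>0. \<exists>y\<in>convex_cone hull S. x = t *\<^sub>R a + y}"
    (is "_ \<subseteq> ?T")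
  proof (rule hull_minimal)
    show "insert a S \<subseteq> ?T"
    proof
      fix x assume x: "x \<in> insert a S"
      show "x \<in> ?T"
      proof (cases "x = a")
        case True
        then have "x = 1 *\<^sub>R a + 0" by simp
        then show ?thesis using convex_cone_hull_contains_0 zero_le_one by blast
      next
        case False
        then have "x \<in> convex_cone hull S" using x by (auto intro: hull_inc)
        moreover have "x = 0 *\<^sub>R a + x" by simp
        ultimately show ?thesis by blast
      qed
    qed
    show "convex_cone ?T"
    proof (rule convex_cone_iff[THEN iffD2], intro conjI ballI allI impI)
      have "0 = 0 *\<^sub>R a + 0" by simp
      then show "0 \<in> ?T"
        using convex_cone_hull_contains_0 by blast
    next
      fix x y assume "x \<in> ?T" "y \<in> ?T"
      then obtain s t u v where "x = s *\<^sub>R a + u" "y = t *\<^sub>R a + v" "s \<ge> 0" "t \<ge> 0"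
        "u \<in> convex_cone hull S" "v \<in> convex_cone hull S"
        by auto
      moreover from this have "x + y = (s + t) *\<^sub>R a + (u + v)"
        by (simp add: algebra_simps)
      ultimately show "x + y \<in> ?T"
        by (auto intro!: exI[of _ "s + t"] bexI[of _ "u + v"] convex_cone_hull_add)
    next
      fix x and c :: real assume "x \<in> ?T" "0 \<le> c"
      then obtain s u where "x = s *\<^sub>R a + u" "s \<ge> 0" "u \<in> convex_cone hull S"
        by auto
      with \<open>0 \<le> c\<close> show "c *\<^sub>R x \<in> ?T"
        by (auto intro!: exI[of _ "c * s"] bexI[of _ "c *\<^sub>R u"] convex_cone_hull_mul
                 simp: scaleR_add_right)
    qed
  qed
  ultimately show "\<exists>t\<ge>0. \<exists>y\<in>convex_cone hull S. x = t *\<^sub>R a + y"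
    by blast
next
  assume "\<exists>t\<ge>0. \<exists>y\<in>convex_cone hull S. x = t *\<^sub>R a + y"
  then show "x \<in> convex_cone hull (insert a S)"
    by (metis convex_cone_hull_add convex_cone_hull_mul hull_inc hull_mono insertI1 subsetD subset_insertI)
qed

text \<open>A nonzero sum has a nonzero summand, which is split off; its coefficient is then
  strictly positive.\<close>

lemma convex_cone_hull_nonzero_decompose:
  assumes "x \<in> convex_cone hull S" "x \<noteq> 0"
  obtains k v y where "k > 0" "v \<in> S" "y \<in> convex_cone hull S" "x = k *\<^sub>R v + y"
proof -
  from assms(1) obtain m :: nat and k v where
    x: "x = (\<Sum>i<m. k i *\<^sub>R v i)" "\<forall>i<m. v i \<in> S \<union> {0} \<and> k i \<ge> (0::real)"
    unfolding root_cone_eq_hull[symmetric] root_cone_def by blast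
  then obtain i where i: "i < m" "k i *\<^sub>R v i \<noteq> 0"
    using assms(2) by (metis (no_types, lifting) lessThan_iff sum.neutral)
  have "k j *\<^sub>R v j \<in> convex_cone hull S" if "j < m" for j
    using x(2) that hull_inc[of "v j" S convex_cone]
    by (auto intro!: convex_cone_hull_mul simp: convex_cone_hull_contains_0)
  then have "(\<Sum>j\<in>{..<m} - {i}. k j *\<^sub>R v j) \<in> convex_cone hull S"
    by (intro sum_in_convex_cone convex_cone_convex_cone_hull) auto
  moreover have "x = k i *\<^sub>R v i + (\<Sum>j\<in>{..<m} - {i}. k j *\<^sub>R v j)"
    unfolding x(1) using i by (intro sum.remove) auto
  ultimately show thesis
    using that i x(2) by (metis (no_types, lifting) UnE less_eq_real_def scaleR_eq_0_iff singletonD)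
qed

section \<open>Hemispaces and walls of a vector configuration\<close>

locale vector_configuration =
  fixes E :: "'v::real_vector set"
  assumes zero_notin: "0 \<notin> E"
    and uminus_in: "x \<in> E \<Longrightarrow> - x \<in> E"
    and reduced: "x \<in> E \<Longrightarrow> k *\<^sub>R x \<in> E \<Longrightarrow> k > 0 \<Longrightarrow> k = 1"
begin

abbreviation half :: "'v set \<Rightarrow> bool" where
  "half \<equiv> hemispace E uminus (cone_in E)"

lemma half_iff:
  "half F \<longleftrightarrow> F \<subseteq> E \<and> convex_cone hull F \<inter> E \<subseteq> F \<and> (\<forall>x\<in>F. - x \<notin> F) \<and> (\<forall>x\<in>E. x \<in> F \<or> - x \<in> F)"
  (is "_ \<longleftrightarrow> ?rhs")
proof
  assume "half F"
  then have "F \<subseteq> E" "convex_cone hull F \<inter> E = F" "F \<inter> uminus ` F = {}" "F \<union> uminus ` F = E"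
    by (auto simp: hemispace_def om_convex_def cone_in_def root_cone_eq_hull)
  then show ?rhs
    by auto
next
  assume ?rhs
  then show "half F"
    using uminus_in hull_subset[of F convex_cone]
    by (auto simp: hemispace_def om_convex_def cone_in_def root_cone_eq_hull image_iff)
       (metis add.inverse_inverse)
qed

lemma
  assumes "half F"
  shows half_subset: "x \<in> F \<Longrightarrow> x \<in> E"
    and half_closed: "x \<in> convex_cone hull F \<Longrightarrow> x \<in> E \<Longrightarrow> x \<in> F"
    and half_uminus_iff: "x \<in> E \<Longrightarrow> - x \<in> F \<longleftrightarrow> x \<notin> F"
  using assms unfolding half_iff by blast+

lemma half_eqI:
  assumes "half F" "half G" "F \<subseteq> G"
  shows "F = G"
  using assms half_subset half_uminus_iff by blast

text \<open>If \<open>x\<close> were nonzero, splitting off a generator \<open>v\<close> from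
  \<open>x\<close> would write \<open>- v\<close> as a positive multiple of \<open>y + - x\<close>.
  Then convexity would place both \<open>v\<close> and \<open>- v\<close> in
  \<open>F\<close>.\<close>

lemma half_hull_pointed:
  assumes F: "half F" and x: "x \<in> convex_cone hull F" "- x \<in> convex_cone hull F"
  shows "x = 0"
proof -
  have False if "k > 0" "v \<in> F" "y \<in> convex_cone hull F" "x = k *\<^sub>R v + y" for k v y
  proof -
    have "- v = (1 / k) *\<^sub>R (y + - x)"
      using that(1,4) by simp
    also have "\<dots> \<in> convex_cone hull F"
      using that x by (intro convex_cone_hull_mul convex_cone_hull_add) auto
    finally have "- v \<in> F"
      using half_closed[OF F] half_subset[OF F] uminus_in that by blast
    then show False
      using half_uminus_iff[OF F] half_subset[OF F] that by blast
  qed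
  then show ?thesis
    using convex_cone_hull_nonzero_decompose[OF x(1)] by blast
qed

text \<open>When \<open>F\<close> is the set of positive roots of a finite root system, these are
  the simple roots.\<close>

definition wall :: "'v set \<Rightarrow> 'v \<Rightarrow> bool" where
  "wall F a \<longleftrightarrow> a \<in> F \<and> a \<notin> convex_cone hull (F - {a})"

definition flip :: "'v \<Rightarrow> 'v set \<Rightarrow> 'v set" where
  "flip a F = insert (- a) (F - {a})"

text \<open>Only convexity has content. A violating \<open>b\<close> equals \<open>y\<close> minus
  \<open>t\<close> times \<open>a\<close> with \<open>y\<close> in the cone of
  \<open>F - {a}\<close>. Since \<open>b\<close> is \<open>a\<close> or \<open>- b\<close> lies in
  \<open>F - {a}\<close>, this puts a nonnegative multiple of \<open>a\<close> into that cone.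
  Indecomposability of \<open>a\<close> forces the multiple to vanish, and then \<open>b\<close>
  lies in \<open>F\<close>.\<close>

lemma half_flip:
  assumes F: "half F" and a: "wall F a"
  shows "half (flip a F)"
proof -
  have aF: "a \<in> F" and aE: "a \<in> E" and a_hull: "a \<notin> convex_cone hull (F - {a})"
    using a half_subset[OF F] by (auto simp: wall_def)
  have neg: "x \<noteq> - x" if "x \<in> E" for x
  proof
    assume "x = - x"
    then have "2 *\<^sub>R x = 0" by (simp add: scaleR_2 eq_neg_iff_add_eq_0)
    then show False using zero_notin that by simp
  qed
  have no_pos: "t *\<^sub>R a \<notin> convex_cone hull (F - {a})" if "t > 0" for t
    using convex_cone_hull_mul[of "t *\<^sub>R a" "F - {a}" "1 / t"] that a_hull by auto
  have "b \<in> flip a F" if b: "b \<in> convex_cone hull (flip a F)" "b \<in> E" for b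
  proof (rule ccontr)
    assume b_notin: "b \<notin> flip a F"
    from b(1) obtain t y where t: "t \<ge> 0" "y \<in> convex_cone hull (F - {a})" "b = t *\<^sub>R (- a) + y"
      unfolding flip_def convex_cone_hull_insert_decompose by auto
    show False
    proof (cases "b = a")
      case True
      then have "(1 + t) *\<^sub>R a = y"
        using t(3) by (simp add: algebra_simps)
      then show False
        using no_pos[of "1 + t"] t by auto
    next
      case False
      then have "b \<notin> F" using b_notin by (auto simp: flip_def)
      then have "- b \<in> F - {a}"
        using half_uminus_iff[OF F b(2)] b_notin by (auto simp: flip_def)
      moreover have "t *\<^sub>R a = y + - b"
        using t(3) by simp
      ultimately have "t *\<^sub>R a \<in> convex_cone hull (F - {a})"
        using t(2) by (metis convex_cone_hull_add hull_inc)
      then have "t = 0"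
        using no_pos t(1) by (metis less_eq_real_def)
      then have "b \<in> convex_cone hull F"
        using t(2,3) hull_mono[of "F - {a}" F convex_cone] by auto
      then show False
        using half_closed[OF F] b(2) \<open>b \<notin> F\<close> by blast
    qed
  qed
  moreover have "\<forall>x\<in>flip a F. - x \<notin> flip a F"
    using half_subset[OF F] half_uminus_iff[OF F] aE aF neg by (auto simp: flip_def equation_minus_iff)
  moreover have "\<forall>x\<in>E. x \<in> flip a F \<or> - x \<in> flip a F"
    using half_uminus_iff[OF F] by (auto simp: flip_def)
  moreover have "flip a F \<subseteq> E"
    using half_subset[OF F] uminus_in aE by (auto simp: flip_def)
  ultimately show ?thesis
    unfolding half_iff by blast
qed

lemma wall_exists:
  assumes F: "half F" and G: "half G" and fin: "finite (F - G)" and ne: "\<not> F \<subseteq> G"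
  obtains a where "wall F a" "a \<notin> G"
proof -
  \<comment> \<open>Any element of a smallest \<open>D\<close> that together with \<open>F \<inter> G\<close> generates the cone of \<open>F\<close>
    is indecomposable.\<close>
  define P where "P D \<longleftrightarrow> D \<subseteq> F - G \<and> F \<subseteq> convex_cone hull (D \<union> (F \<inter> G))" for D
  have "P (F - G)"
    using hull_subset[of F convex_cone] by (auto simp: P_def Un_Diff_Int)
  then obtain D where D: "P D" and D_min: "\<And>D'. P D' \<Longrightarrow> card D \<le> card D'"
    by (metis ex_has_least_nat)
  then have D_sub: "D \<subseteq> F - G" and D_hull: "F \<subseteq> convex_cone hull (D \<union> (F \<inter> G))"
    by (auto simp: P_def)
  \<comment> \<open>Otherwise \<open>F\<close> lies in the cone of \<open>G\<close>, hence in
    \<open>G\<close>.\<close>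
  have "D \<noteq> {}"
  proof
    assume "D = {}"
    then have "F \<subseteq> convex_cone hull G"
      using D_hull hull_mono[of "F \<inter> G" G convex_cone] by auto
    then show False
      using half_closed[OF G] half_subset[OF F] ne by blast
  qed
  then obtain a where a: "a \<in> D" by blast
  define S where "S = (D - {a}) \<union> (F \<inter> G)"
  have ins: "D \<union> (F \<inter> G) = insert a S" using a by (auto simp: S_def)
  have SF: "S \<subseteq> F" using D_sub by (auto simp: S_def)
  have aF: "a \<in> F" "a \<in> E" "a \<noteq> 0" "a \<notin> G"
    using D_sub a half_subset[OF F] zero_notin by blast+
  have S_hull: "convex_cone hull S \<subseteq> convex_cone hull F"
    using SF by (rule hull_mono)
  have a_S: "a \<notin> convex_cone hull S"
  proof
    assume "a \<in> convex_cone hull S"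
    then have "convex_cone hull (insert a S) = convex_cone hull S"
      by (rule hull_redundant)
    then have "P (D - {a})"
      using D_hull D_sub unfolding ins by (auto simp: P_def S_def)
    then have "card D \<le> card (D - {a})" by (rule D_min)
    moreover have "finite D" using D_sub fin by (rule finite_subset)
    ultimately show False using a by (metis card_Diff1_less leD)
  qed
  \<comment> \<open>If \<open>t < 1\<close>, solving for \<open>a\<close> puts it in the cone of
    \<open>S\<close>, against minimality of \<open>D\<close>. If \<open>t\<close> is at least 1,
    then \<open>- r\<close> is in the cone of \<open>F\<close>, which is pointed.\<close>
  have contra: False
    if t: "t \<ge> 0" "r \<in> convex_cone hull S" "r \<noteq> 0" "a = t *\<^sub>R a + r" for t r
  proof (cases "t < 1")
    case True
    have "(1 - t) *\<^sub>R a = r" using t(4) by (simp add: algebra_simps)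
    then have "a = (1 / (1 - t)) *\<^sub>R r" using True by auto
    also have "\<dots> \<in> convex_cone hull S" using True t by (intro convex_cone_hull_mul) auto
    finally show False using a_S by blast
  next
    case False
    have "- r = (t - 1) *\<^sub>R a" using t(4) by (simp add: algebra_simps)
    also have "\<dots> \<in> convex_cone hull F" using False aF by (intro convex_cone_hull_mul hull_inc) auto
    finally show False
      using half_hull_pointed[OF F, of r] S_hull t by blast
  qed
  have hull_decompose: "\<exists>t\<ge>0. \<exists>r\<in>convex_cone hull S. y = t *\<^sub>R a + r" if "y \<in> convex_cone hull F" for y
  proof -
    have "convex_cone hull F \<subseteq> convex_cone hull (insert a S)"
      using D_hull unfolding ins by (simp add: hull_minimal convex_cone_convex_cone_hull)
    then show ?thesis
      using that by (auto simp: convex_cone_hull_insert_decompose subset_iff)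
  qed
  have "a \<notin> convex_cone hull (F - {a})"
  proof
    assume "a \<in> convex_cone hull (F - {a})"
    then obtain k v y where k: "k > 0" and v: "v \<in> F" "v \<noteq> a"
      and y: "y \<in> convex_cone hull (F - {a})" and a_eq: "a = k *\<^sub>R v + y"
      using convex_cone_hull_nonzero_decompose[OF _ aF(3)] by (metis DiffE singletonI)
    \<comment> \<open>Both parts of the decomposition of \<open>a\<close> are expanded over
      \<open>a\<close> and \<open>S\<close>. Adding them gives an equation of the shape excluded by
      \<open>contra\<close>, once the total \<open>S\<close>-part is known to be nonzero.\<close>
    obtain t r where t: "t \<ge> 0" "r \<in> convex_cone hull S" "v = t *\<^sub>R a + r"
      using hull_decompose[OF hull_inc[OF v(1)]] by blast
    obtain t' r' where t': "t' \<ge> 0" "r' \<in> convex_cone hull S" "y = t' *\<^sub>R a + r'"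
      using hull_decompose[OF subsetD[OF hull_mono y]] by blast
    \<comment> \<open>Otherwise \<open>v\<close> is a positive multiple of \<open>a\<close>, so
      \<open>v = a\<close> because each ray carries at most one element.\<close>
    have "r \<noteq> 0"
    proof
      assume "r = 0"
      then have "t *\<^sub>R a \<in> E" "t > 0"
        using t v half_subset[OF F] zero_notin by (auto simp: less_le)
      then show False
        using reduced[of a t] aF(2) t(3) v(2) \<open>r = 0\<close> by simp
    qed
    have "k *\<^sub>R r + r' \<noteq> 0"
    proof
      assume "k *\<^sub>R r + r' = 0"
      then have "- (k *\<^sub>R r) = r'" by (simp add: add_eq_0_iff)
      moreover have "k *\<^sub>R r \<in> convex_cone hull S" using k t by (intro convex_cone_hull_mul) auto
      ultimately have "k *\<^sub>R r = 0"
        using half_hull_pointed[OF F, of "k *\<^sub>R r"] S_hull t' by auto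
      then show False using k \<open>r \<noteq> 0\<close> by simp
    qed
    moreover have "a = (k * t + t') *\<^sub>R a + (k *\<^sub>R r + r')"
      using a_eq unfolding t(3) t'(3) by (simp add: algebra_simps)
    moreover have "k * t + t' \<ge> 0" using k t t' by simp
    moreover have "k *\<^sub>R r + r' \<in> convex_cone hull S"
      using k t t' by (intro convex_cone_hull_add convex_cone_hull_mul) auto
    ultimately show False using contra by blast
  qed
  then show thesis using that aF by (auto simp: wall_def)
qed

text \<open>In the span of two walls, every element of \<open>F\<close> has nonnegative coordinates,
  as for simple roots of a rank two system.\<close>

lemma two_walls_span:
  assumes F: "half F" and a: "wall F a" and b: "wall F b" and ab: "a \<noteq> b"
  shows "F \<inter> span {a, b} = convex_cone hull {a, b} \<inter> E"
proof
  have abF: "a \<in> F" "b \<in> F" using a b by (auto simp: wall_def)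
  show "convex_cone hull {a, b} \<inter> E \<subseteq> F \<inter> span {a, b}"
  proof -
    have "convex_cone hull {a, b} \<subseteq> convex_cone hull F"
      using abF by (intro hull_mono) auto
    moreover have "convex_cone hull {a, b} \<subseteq> span {a, b}"
      by (rule hull_minimal)
         (auto simp: convex_cone_iff intro: span_base span_add span_mul span_zero)
    ultimately show ?thesis using half_closed[OF F] by blast
  qed
  \<comment> \<open>The walls are quantified afresh so that the roles of \<open>a\<close> and
    \<open>b\<close> can be exchanged. For negative \<open>p\<close> and positive \<open>q\<close>,
    \<open>b\<close> would be a combination of \<open>x\<close> and \<open>a\<close>; this
    contradicts that \<open>b\<close> is a wall unless \<open>x = b\<close>, where \<open>a\<close>
    and \<open>b\<close> are proportional. For \<open>q\<close> at most 0, \<open>- x\<close> lies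
    in the pointed cone of \<open>F\<close>.\<close>
  have nonneg: "p \<ge> 0"
    if x: "x \<in> F" "x = p *\<^sub>R a + q *\<^sub>R b" and w: "wall F a" "wall F b" "a \<noteq> b" for x p q a b
  proof (rule ccontr)
    assume "\<not> p \<ge> 0"
    then have p: "- p > 0" by simp
    have F': "a \<in> F" "b \<in> F" using w by (auto simp: wall_def)
    have qb: "q *\<^sub>R b = x + (- p) *\<^sub>R a" using x by simp
    show False
    proof (cases "q > 0")
      case True
      show False
      proof (cases "x = b")
        case True
        then have *: "(1 - q) *\<^sub>R b = p *\<^sub>R a" using x by (simp add: algebra_simps)
        have "((1 - q) / p) *\<^sub>R b = (1 / p) *\<^sub>R ((1 - q) *\<^sub>R b)" by simp
        also have "\<dots> = a" unfolding * using p by simp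
        finally have eq: "((1 - q) / p) *\<^sub>R b = a" .
        show False
        proof (cases "(1 - q) / p > 0")
          case True
          then show False using reduced[of b "(1 - q) / p"] F' half_subset[OF F] eq w(3) by auto
        next
          case False
          have "- a = (- ((1 - q) / p)) *\<^sub>R b" using eq by simp
          also have "\<dots> \<in> convex_cone hull F"
            using False F' by (intro convex_cone_hull_mul hull_inc) auto
          finally have "a = 0"
            using half_hull_pointed[OF F, of a] F' by (auto intro: hull_inc)
          then show False using zero_notin F' half_subset[OF F] by auto
        qed
      next
        case False
        have "b = (1 / q) *\<^sub>R (x + (- p) *\<^sub>R a)" using \<open>q > 0\<close> unfolding qb[symmetric] by simp
        also have "\<dots> \<in> convex_cone hull (F - {b})"
          using \<open>q > 0\<close> p x(1) F' False w(3)
          by (intro convex_cone_hull_mul convex_cone_hull_add) (auto intro: hull_inc)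
        finally show False using w(2) by (auto simp: wall_def)
      qed
    next
      case False
      have "x + (- p) *\<^sub>R a + (- q) *\<^sub>R b = 0" using x by simp
      then have "- x = (- p) *\<^sub>R a + (- q) *\<^sub>R b" by (simp add: x)
      also have "\<dots> \<in> convex_cone hull F"
        using p False F' by (intro convex_cone_hull_mul convex_cone_hull_add hull_inc) auto
      finally have "x = 0" using half_hull_pointed[OF F, of x] x(1) by (auto intro: hull_inc)
      then show False using zero_notin x(1) half_subset[OF F] by auto
    qed
  qed
  show "F \<inter> span {a, b} \<subseteq> convex_cone hull {a, b} \<inter> E"
  proof
    fix x assume x: "x \<in> F \<inter> span {a, b}"
    then obtain p q where pq: "x = p *\<^sub>R a + q *\<^sub>R b"
      by (auto simp: span_insert span_singleton algebra_simps)
    then have "p \<ge> 0" "q \<ge> 0"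
      using nonneg[of x p a q b] nonneg[of x q b p a] x a b ab by (auto simp: add.commute)
    then show "x \<in> convex_cone hull {a, b} \<inter> E"
      using x half_subset[OF F] unfolding pq
      by (intro IntI convex_cone_hull_add convex_cone_hull_mul hull_inc) auto
  qed
qed

end

context vector_configuration
begin

text \<open>Negation turns \<open>x\<close> into a combination of \<open>- a\<close> and
  \<open>- b\<close>, which both lie in \<open>G\<close>. Thus a hemispace that reverses two walls
  reverses everything they generate.\<close>

lemma half_disjoint_hull:
  assumes G: "half G" and ab: "a \<in> E" "b \<in> E" "a \<notin> G" "b \<notin> G"
  shows "(convex_cone hull {a, b} \<inter> E) \<inter> G = {}"
proof -
  have "x \<notin> G" if x: "x \<in> convex_cone hull {a, b}" "x \<in> E" for x
  proof -
    have "- x \<in> convex_cone hull (uminus ` {a, b})"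
      using x(1) unfolding convex_cone_hull_linear_image[OF linear_uminus] by blast
    also have "\<dots> \<subseteq> convex_cone hull G"
      using half_uminus_iff[OF G] ab by (intro hull_mono) auto
    finally have "- x \<in> G"
      using half_closed[OF G] uminus_in x(2) by blast
    then show ?thesis
      using half_uminus_iff[OF G x(2)] by blast
  qed
  then show ?thesis by blast
qed

text \<open>Moving upwards from the base \<open>B\<close> never undoes a reversal, so only elements
  of \<open>B\<close> change sign.\<close>

lemma half_Diff_subset:
  assumes B: "half B" and F: "half F" and G: "half G" and le: "B - F \<subseteq> B - G"
  shows "F - G \<subseteq> B"
proof
  fix v assume v: "v \<in> F - G"
  then have "v \<in> E" using half_subset[OF F] by blast
  then show "v \<in> B"
    using v le half_uminus_iff[OF B] half_uminus_iff[OF F] half_uminus_iff[OF G] by blast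
qed

end

section \<open>Reflections and rank two reversals\<close>

text \<open>Coroots are given as linear functionals \<open>c a\<close> rather than through an inner
  product, since the form on the affine space is degenerate in the direction of \<delta>.\<close>

locale reflection_configuration = vector_configuration E for E :: "'v::real_vector set" +
  fixes c :: "'v \<Rightarrow> 'v \<Rightarrow> real"
  assumes linear_coroot: "a \<in> E \<Longrightarrow> linear (c a)"
    and coroot_self: "a \<in> E \<Longrightarrow> c a a = 2"
    and reflection_closed: "a \<in> E \<Longrightarrow> b \<in> E \<Longrightarrow> b - c a b *\<^sub>R a \<in> E"
begin

definition reflect :: "'v \<Rightarrow> 'v \<Rightarrow> 'v" where
  "reflect a x = x - c a x *\<^sub>R a"

lemma
  assumes "a \<in> E"
  shows linear_reflect: "linear (reflect a)"
    and reflect_self: "reflect a a = - a"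
    and reflect_reflect: "reflect a (reflect a x) = x"
    and reflect_in: "b \<in> E \<Longrightarrow> reflect a b \<in> E"
proof -
  interpret c: linear "c a" by (rule linear_coroot[OF assms])
  show "linear (reflect a)"
    by (rule linearI) (simp_all add: reflect_def c.add c.scale algebra_simps)
  have "a - 2 *\<^sub>R a = - a" by (simp add: scaleR_2)
  then show "reflect a a = - a" by (simp add: reflect_def coroot_self[OF assms])
  show "reflect a (reflect a x) = x"
    by (simp add: reflect_def c.diff c.scale coroot_self[OF assms] algebra_simps)
  show "b \<in> E \<Longrightarrow> reflect a b \<in> E"
    using reflection_closed assms by (simp add: reflect_def)
qed

lemma inj_reflect: "a \<in> E \<Longrightarrow> inj (reflect a)"
  by (metis injI reflect_reflect)

lemma half_reflect:
  assumes a: "a \<in> E" and F: "half F"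
  shows "half (reflect a ` F)"
proof -
  interpret r: linear "reflect a" by (rule linear_reflect[OF a])
  have mem: "x \<in> reflect a ` S \<longleftrightarrow> reflect a x \<in> S" for x S
    using reflect_reflect[OF a] by (metis image_iff)
  have hull: "convex_cone hull (reflect a ` F) = reflect a ` (convex_cone hull F)"
    by (rule convex_cone_hull_linear_image) (rule linear_reflect[OF a])
  have E: "reflect a x \<in> E \<longleftrightarrow> x \<in> E" for x
    using reflect_in[OF a] reflect_reflect[OF a] by metis
  show ?thesis
    using F E half_subset[OF F] unfolding half_iff hull subset_iff Ball_def
    by (simp add: mem r.neg) (metis E)
qed

lemma wall_reflect:
  assumes a: "a \<in> E" and w: "wall F b"
  shows "wall (reflect a ` F) (reflect a b)"
proof -
  have "reflect a ` F - {reflect a b} = reflect a ` (F - {b})"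
    using inj_reflect[OF a] by (auto dest: injD)
  then show ?thesis
    using w by (simp add: wall_def convex_cone_hull_linear_image linear_reflect[OF a]
        inj_image_mem_iff[OF inj_reflect[OF a]])
qed

text \<open>A simple reflection permutes the other positive roots: \<open>reflect a x\<close> is
  \<open>x\<close> plus a nonnegative multiple of \<open>a\<close> or of \<open>- a\<close>, so it
  lies in the cone of \<open>F\<close> or of \<open>flip a F\<close>. Inclusion between hemispaces
  is equality. Together with \<open>wall_reflect\<close> this identifies walls of the flipped
  hemispace.\<close>

lemma reflect_image_wall:
  assumes F: "half F" and w: "wall F a"
  shows "reflect a ` F = flip a F"
proof -
  have aF: "a \<in> F" and aE: "a \<in> E"
    using w half_subset[OF F] by (auto simp: wall_def)
  have flip: "half (flip a F)" by (rule half_flip[OF F w])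
  have "reflect a x \<in> flip a F" if x: "x \<in> F" for x
  proof (cases "x = a")
    case True
    then show ?thesis by (simp add: reflect_self[OF aE] flip_def)
  next
    case False
    have xE: "reflect a x \<in> E" using reflect_in[OF aE] half_subset[OF F] x by blast
    have eq: "reflect a x = x + (- c a x) *\<^sub>R a" by (simp add: reflect_def)
    show ?thesis
    proof (cases "c a x \<le> 0")
      case True
      have "reflect a x \<in> convex_cone hull F"
        unfolding eq using True x aF
        by (intro convex_cone_hull_add convex_cone_hull_mul hull_inc) auto
      then have "reflect a x \<in> F" using half_closed[OF F] xE by blast
      moreover have "reflect a x \<noteq> a"
      proof
        assume "reflect a x = a"
        then have "x = - a" using reflect_reflect[OF aE, of x] reflect_self[OF aE] by simp
        then show False using half_uminus_iff[OF F aE] aF x by blast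
      qed
      ultimately show ?thesis by (simp add: flip_def)
    next
      case c: False
      have "reflect a x = x + c a x *\<^sub>R (- a)" by (simp add: reflect_def)
      also have "\<dots> \<in> convex_cone hull (flip a F)"
        using c False x
        by (intro convex_cone_hull_add convex_cone_hull_mul hull_inc) (auto simp: flip_def)
      finally show ?thesis using half_closed[OF flip] xE by blast
    qed
  qed
  then show ?thesis
    by (intro half_eqI half_reflect aE F flip) auto
qed

lemma rank_two_opposite:
  assumes F: "half F" and w: "wall F a" "wall F b" and ab: "a \<noteq> b"
    and fin: "finite (convex_cone hull {a, b} \<inter> E)"
  obtains K where "half K" "F - K = convex_cone hull {a, b} \<inter> E"
proof -
  define L where "L = span {a, b}"
  have FL: "F \<inter> L = convex_cone hull {a, b} \<inter> E"
    unfolding L_def by (rule two_walls_span[OF F w ab])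
  \<comment> \<open>\<open>X\<close> contains the orbit of \<open>F\<close> under the dihedral group generated by the reflections in
    \<open>a\<close> and \<open>b\<close>; the member farthest from \<open>F\<close> has all of \<open>F \<inter> L\<close> reversed.\<close>
  define X where "X K \<longleftrightarrow> half K \<and> K - L = F - L \<and>
    (\<exists>p q. wall K p \<and> wall K q \<and> p \<noteq> q \<and> span {p, q} = L)" for K
  have Diff_sub: "F - K \<subseteq> F \<inter> L" if "X K" for K
    using that by (auto simp: X_def)
  have fin_Diff: "finite (F - K)" if "X K" for K
    using Diff_sub[OF that] fin unfolding FL by (rule finite_subset)
  have "X F" using F w ab by (auto simp: X_def L_def)
  \<comment> \<open>The bound guarantees that a member of \<open>X\<close> farthest from
    \<open>F\<close> exists.\<close>
  moreover have "\<forall>K. X K \<longrightarrow> card (F - K) < Suc (card (F \<inter> L))"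
    using Diff_sub fin unfolding FL[symmetric] by (simp add: less_Suc_eq_le card_mono)
  ultimately obtain K where K: "X K" and K_max: "\<And>K'. X K' \<Longrightarrow> card (F - K') \<le> card (F - K)"
    using ex_has_greatest_nat[of X F "\<lambda>K. card (F - K)"] by blast
  \<comment> \<open>A wall \<open>p\<close> of \<open>K\<close> still in \<open>F\<close> could be
    flipped: the result stays in \<open>X\<close>, with the reflected walls, and has one more
    reversed element than \<open>K\<close>.\<close>
  have step: "p \<notin> F" if pq: "wall K p" "wall K q" "p \<noteq> q" "span {p, q} = L" for p q
  proof
    assume pF: "p \<in> F"
    have hK: "half K" and KL: "K - L = F - L" using K by (auto simp: X_def)
    have pK: "p \<in> K" and pE: "p \<in> E"
      using pq half_subset[OF hK] by (auto simp: wall_def)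
    have img: "reflect p ` K = flip p K" by (rule reflect_image_wall[OF hK pq(1)])
    have "wall (flip p K) (reflect p p)" "wall (flip p K) (reflect p q)"
      using wall_reflect[OF pE] pq unfolding img[symmetric] by blast+
    moreover have "reflect p p \<noteq> reflect p q"
      using pq(3) inj_reflect[OF pE] by (auto dest: injD)
    moreover have "span {reflect p p, reflect p q} = L"
    proof -
      have in_span: "x *\<^sub>R u + y *\<^sub>R v \<in> span {u, v}" for x y and u v :: 'v
        by (intro span_add span_scale span_base) auto
      have "reflect p p = (- 1) *\<^sub>R p + 0 *\<^sub>R q" "reflect p q = (- c p q) *\<^sub>R p + 1 *\<^sub>R q"
        by (auto simp: reflect_self[OF pE]) (simp add: reflect_def)
      then have "{reflect p p, reflect p q} \<subseteq> span {p, q}"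
        using in_span by (metis empty_subsetI insert_subset)
      moreover have "p = (- 1) *\<^sub>R reflect p p + 0 *\<^sub>R reflect p q"
        "q = (- c p q) *\<^sub>R reflect p p + 1 *\<^sub>R reflect p q"
        by (auto simp: reflect_self[OF pE]) (simp add: reflect_def)
      then have "{p, q} \<subseteq> span {reflect p p, reflect p q}"
        using in_span by (metis empty_subsetI insert_subset)
      ultimately show ?thesis
        using pq(4) by (metis span_minimal subset_antisym subspace_span)
    qed
    moreover have "flip p K - L = F - L"
    proof -
      have "p \<in> L" unfolding pq(4)[symmetric] by (simp add: span_base)
      moreover from this have "- p \<in> L" unfolding L_def by (rule span_neg)
      ultimately show ?thesis using KL by (auto simp: flip_def)
    qed
    moreover have "half (flip p K)" by (rule half_flip[OF hK pq(1)])
    ultimately have "X (flip p K)" unfolding X_def by blast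
    then have "card (F - flip p K) \<le> card (F - K)" by (rule K_max)
    moreover have "F - flip p K = insert p (F - K)"
      using pF pK pE half_uminus_iff[OF F pE] half_uminus_iff[OF hK pE] zero_notin
      by (auto simp: flip_def)
    ultimately show False using fin_Diff[OF K] pK by simp
  qed
  obtain p q where pq: "wall K p" "wall K q" "p \<noteq> q" "span {p, q} = L"
    using K by (auto simp: X_def)
  have hK: "half K" using K by (simp add: X_def)
  have "p \<notin> F" "q \<notin> F" "p \<in> E" "q \<in> E"
    using step[of p q] step[of q p] pq half_subset[OF hK]
    by (auto simp: insert_commute wall_def)
  \<comment> \<open>Both walls of \<open>K\<close> in the plane are now outside \<open>F\<close>,
    hence so is all of \<open>K\<close> within \<open>L\<close>, which they generate.\<close>
  then have "(K \<inter> L) \<inter> F = {}"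
    using half_disjoint_hull[OF F] two_walls_span[OF hK pq(1,2,3)] pq(4) by simp
  then have "F - K = F \<inter> L" using Diff_sub[OF K] by blast
  then show thesis using that[OF hK] FL by simp
qed

section \<open>Joins above a base hemispace\<close>

text \<open>Induction on the distance from a common lower bound \<open>z\<close> to \<open>T\<close>, as in the criterion of
  Bjorner, Edelman and Ziegler: it suffices to join the covers of a given element.\<close>

lemma join_exists_above:
  assumes B: "half B" and T: "half T" and fin: "finite (B - T)"
    and z: "half z" "B - z \<subseteq> B - x" "B - z \<subseteq> B - y"
    and x: "half x" "B - x \<subseteq> B - T" and y: "half y" "B - y \<subseteq> B - T"
  shows "\<exists>j. half j \<and> B - x \<subseteq> B - j \<and> B - y \<subseteq> B - j \<and> B - j \<subseteq> B - T \<and>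
    (\<forall>m. half m \<and> B - x \<subseteq> B - m \<and> B - y \<subseteq> B - m \<longrightarrow> B - j \<subseteq> B - m)"
    (is "\<exists>j. ?join x y j")
  using z x y
proof (induction "card ((B - T) - (B - z))" arbitrary: z x y rule: less_induct)
  case less
  note z = less.prems(1-3) and x = less.prems(4,5) and y = less.prems(6,7)
  \<comment> \<open>Whenever \<open>x\<close> is strictly above \<open>z\<close>, some wall of
    \<open>z\<close> is reversed in \<open>x\<close>; flipping it gives a cover of \<open>z\<close>
    that lies closer to \<open>T\<close>.\<close>
  have cover: "\<exists>a. wall z a \<and> a \<in> z - x \<and> a \<in> B \<and> half (flip a z) \<and> B - flip a z = insert a (B - z) \<and>
      card ((B - T) - (B - flip a z)) < card ((B - T) - (B - z))"
    if x: "half x" "B - z \<subseteq> B - x" "B - x \<subseteq> B - T" "\<not> B - x \<subseteq> B - z" for x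
  proof -
    have sub: "z - x \<subseteq> B" by (rule half_Diff_subset[OF B z(1) x(1,2)])
    then have "z - x \<subseteq> B - T" using x by blast
    then have "finite (z - x)" using fin by (rule finite_subset)
    moreover have "\<not> z \<subseteq> x" using half_eqI[OF z(1) x(1)] x(4) by blast
    ultimately obtain a where a: "wall z a" "a \<notin> x"
      using wall_exists[OF z(1) x(1)] by blast
    then have az: "a \<in> z - x" by (simp add: wall_def)
    then have aB: "a \<in> B" using sub by blast
    then have "- a \<notin> B" using half_uminus_iff[OF B] half_subset[OF B] by blast
    then have eq: "B - flip a z = insert a (B - z)"
      using az aB by (auto simp: flip_def)
    moreover have "card ((B - T) - (B - flip a z)) < card ((B - T) - (B - z))"
      using fin az aB x(3) unfolding eq by (intro psubset_card_mono) auto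
    ultimately show ?thesis using a az aB half_flip[OF z(1)] by blast
  qed
  consider "B - x \<subseteq> B - z" | "B - y \<subseteq> B - z" | "\<not> B - x \<subseteq> B - z" "\<not> B - y \<subseteq> B - z"
    by blast
  then show ?case
  proof cases
    case 1
    then have "B - x \<subseteq> B - y" using z(3) by (rule order.trans)
    then show ?thesis using y by (intro exI[of _ y]) simp
  next
    case 2
    then have "B - y \<subseteq> B - x" using z(2) by (rule order.trans)
    then show ?thesis using x by (intro exI[of _ x]) simp
  next
    case 3
    obtain a where a: "wall z a" "a \<in> z - x" "a \<in> B" "half (flip a z)"
      "B - flip a z = insert a (B - z)"
      "card ((B - T) - (B - flip a z)) < card ((B - T) - (B - z))"
      using cover[OF x(1) z(2) x(2) 3(1)] by blast
    obtain b where b: "wall z b" "b \<in> z - y" "b \<in> B" "half (flip b z)"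
      "B - flip b z = insert b (B - z)"
      "card ((B - T) - (B - flip b z)) < card ((B - T) - (B - z))"
      using cover[OF y(1) z(3) y(2) 3(2)] by blast
    have ax: "B - flip a z \<subseteq> B - x" and bY: "B - flip b z \<subseteq> B - y"
      using a b z by auto
    show ?thesis
    proof (cases "a = b")
      \<comment> \<open>The common cover replaces \<open>z\<close> as lower bound.\<close>
      case True
      then show ?thesis
        using less.hyps[OF a(6,4) ax _ x y] bY by simp
    next
      case False
      define N where "N = convex_cone hull {a, b} \<inter> E"
      have abE: "a \<in> E" "b \<in> E" using half_subset[OF B] a(3) b(3) by auto
      have N_disjoint: "N \<inter> m = {}" if "half m" "a \<notin> m" "b \<notin> m" for m
        unfolding N_def by (rule half_disjoint_hull[OF that(1) abE that(2,3)])
      have N_sub: "N \<subseteq> m" if "half m" "a \<in> m" "b \<in> m" for m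
      proof -
        have "convex_cone hull {a, b} \<subseteq> convex_cone hull m"
          using that by (intro hull_mono) auto
        then show ?thesis unfolding N_def using half_closed[OF that(1)] by blast
      qed
      have NB: "N \<subseteq> B" by (rule N_sub[OF B a(3) b(3)])
      have "a \<notin> T" "b \<notin> T" using a b x y by auto
      then have NT: "N \<subseteq> B - T" using N_disjoint[OF T] NB by blast
      then have "finite N" using fin by (rule finite_subset)
      then obtain k where k: "half k" "z - k = N"
        using rank_two_opposite[OF z(1) a(1) b(1) False] unfolding N_def by blast
      have "B - k = (B - z) \<union> N"
      proof
        show "B - k \<subseteq> (B - z) \<union> N" using k by blast
        have "v \<notin> k" if "v \<in> B - z" for v
        proof
          assume "v \<in> k"
          moreover have "v \<in> E" using that half_subset[OF B] by blast
          ultimately have "- v \<in> N"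
            using that k half_uminus_iff[OF z(1)] half_uminus_iff[OF k(1)] by blast
          then show False
            using NB that half_uminus_iff[OF B \<open>v \<in> E\<close>] by blast
        qed
        then show "(B - z) \<union> N \<subseteq> B - k" using NB k by blast
      qed
      moreover have "a \<in> N" "b \<in> N"
        unfolding N_def using abE by (auto intro: hull_inc)
      ultimately have k_ge: "B - flip a z \<subseteq> B - k" "B - flip b z \<subseteq> B - k"
        and Bk: "B - k = (B - z) \<union> N"
        unfolding a(5) b(5) by auto
      have kT: "B - k \<subseteq> B - T" using Bk NT z(2) x(2) by blast
      have k_le: "B - k \<subseteq> B - m" if "half m" "B - z \<subseteq> B - m" "a \<notin> m" "b \<notin> m" for m
        using N_disjoint[OF that(1,3,4)] that(2) NB unfolding Bk by blast
      \<comment> \<open>Two applications of the induction hypothesis: \<open>x\<close> and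
        \<open>k\<close> are joined above \<open>flip a z\<close>, then \<open>y\<close> and the
        result \<open>u\<close> above \<open>flip b z\<close>. An upper bound of \<open>x\<close>
        and \<open>y\<close> reverses \<open>a\<close> and \<open>b\<close>, so it is above
        \<open>k\<close>, then \<open>u\<close>, then \<open>j\<close>.\<close>
      obtain u where u: "?join x k u"
        using less.hyps[OF a(6,4) ax k_ge(1) x k(1) kT] by (rule exE)
      then have u': "half u" "B - x \<subseteq> B - u" "B - k \<subseteq> B - u" "B - u \<subseteq> B - T"
        by simp_all
      have bu: "B - flip b z \<subseteq> B - u" by (rule order.trans[OF k_ge(2) u'(3)])
      obtain j where j: "?join y u j"
        using less.hyps[OF b(6,4) bY bu y u'(1,4)] by (rule exE)
      have "B - j \<subseteq> B - m" if m: "half m" "B - x \<subseteq> B - m" "B - y \<subseteq> B - m" for m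
      proof -
        have "a \<notin> m" "b \<notin> m" "B - z \<subseteq> B - m" using a b m z by blast+
        then have "B - k \<subseteq> B - m" using k_le m(1) by blast
        then have "B - u \<subseteq> B - m" using u m by simp
        then show ?thesis using j m by simp
      qed
      moreover have "B - u \<subseteq> B - j" using j by simp
      with u'(2) have "B - x \<subseteq> B - j" by (rule order.trans)
      ultimately show ?thesis using j by (intro exI[of _ j]) simp
    qed
  qed
qed

end

section \<open>Comparing tope posets with different base hemispaces\<close>

context vector_configuration
begin

text \<open>For \<open>F\<close> above \<open>B\<close>, the symmetric difference of
  \<open>F\<close> and \<open>H\<close> is the disjoint union of those of \<open>B\<close> with
  \<open>H\<close> and of \<open>B\<close> with \<open>F\<close>. The latter is stable under
  negation, so \<open>B - F\<close> determines it. Hence \<open>B\<close> may replace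
  \<open>H\<close> as base.\<close>

lemma sym_diff_le_iff_lower:
  assumes "half H" "half B" "half F" "half G"
    and "sym_diff B H \<subseteq> sym_diff F H" "sym_diff B H \<subseteq> sym_diff G H"
  shows "sym_diff F H \<subseteq> sym_diff G H \<longleftrightarrow> B - F \<subseteq> B - G"
proof
  assume le: "sym_diff F H \<subseteq> sym_diff G H"
  show "B - F \<subseteq> B - G"
    using le assms(5,6) by blast
next
  assume le: "B - F \<subseteq> B - G"
  have "v \<in> sym_diff G H" if v: "v \<in> sym_diff F H" for v
  proof -
    have "v \<in> E" using v half_subset assms(1,3) by blast
    then have "v \<in> B \<or> - v \<in> B" "- v \<in> F \<longleftrightarrow> v \<notin> F" "- v \<in> G \<longleftrightarrow> v \<notin> G"
      using half_uminus_iff assms(2-4) by blast+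
    then show ?thesis using v le assms(5,6) by blast
  qed
  then show "sym_diff F H \<subseteq> sym_diff G H" by blast
qed

text \<open>Dually, below \<open>T\<close> the set separating \<open>F\<close> from \<open>T\<close>
  is the complement of \<open>sym_diff F H\<close> in \<open>sym_diff T H\<close>, so basing at
  \<open>T\<close> reverses the order.\<close>

lemma sym_diff_le_iff_upper:
  assumes "half H" "half T" "half F" "half G"
    and "sym_diff F H \<subseteq> sym_diff T H" "sym_diff G H \<subseteq> sym_diff T H"
  shows "sym_diff F H \<subseteq> sym_diff G H \<longleftrightarrow> T - G \<subseteq> T - F"
proof
  assume le: "sym_diff F H \<subseteq> sym_diff G H"
  show "T - G \<subseteq> T - F"
    using le assms(5,6) by blast
next
  assume le: "T - G \<subseteq> T - F"
  have "v \<in> sym_diff G H" if v: "v \<in> sym_diff F H" for v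
  proof -
    have "v \<in> E" using v half_subset assms(1,3) by blast
    then have "v \<in> T \<or> - v \<in> T" "- v \<in> F \<longleftrightarrow> v \<notin> F" "- v \<in> G \<longleftrightarrow> v \<notin> G"
      using half_uminus_iff assms(2-4) by blast+
    then show ?thesis using v le assms(5,6) by blast
  qed
  then show "sym_diff F H \<subseteq> sym_diff G H" by blast
qed

text \<open>The elements separating \<open>B\<close> from \<open>F\<close> are among those
  separating \<open>B\<close> from \<open>T\<close>, and these avoid
  \<open>sym_diff B H\<close>.\<close>

lemma sym_diff_between_lower:
  assumes "half H" "half B" "half T" "half F"
    and "sym_diff B H \<subseteq> sym_diff T H" "B - F \<subseteq> B - T"
  shows "sym_diff B H \<subseteq> sym_diff F H"
proof -
  have "v \<in> sym_diff F H" if v: "v \<in> sym_diff B H" for v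
  proof -
    have "v \<in> E" using v half_subset assms(1,2) by blast
    then have "- v \<in> B \<longleftrightarrow> v \<notin> B" "- v \<in> F \<longleftrightarrow> v \<notin> F" "- v \<in> T \<longleftrightarrow> v \<notin> T"
      using half_uminus_iff assms(2-4) by blast+
    then show ?thesis using v assms(5,6) by blast
  qed
  then show ?thesis by blast
qed

lemma sym_diff_between_upper:
  assumes "half H" "half B" "half T" "half F"
    and "sym_diff B H \<subseteq> sym_diff T H" "T - F \<subseteq> T - B"
  shows "sym_diff F H \<subseteq> sym_diff T H"
proof -
  have "v \<in> sym_diff T H" if v: "v \<in> sym_diff F H" for v
  proof -
    have "v \<in> E" using v half_subset assms(1,4) by blast
    then have "- v \<in> B \<longleftrightarrow> v \<notin> B" "- v \<in> F \<longleftrightarrow> v \<notin> F" "- v \<in> T \<longleftrightarrow> v \<notin> T"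
      using half_uminus_iff assms(2-4) by blast+
    then show ?thesis using v assms(5,6) by blast
  qed
  then show ?thesis by blast
qed

end

section \<open>The interval as a lattice\<close>

context reflection_configuration
begin

lemma lattice_tope_interval:
  assumes H: "half H" and H1: "half H1" and H2: "half H2"
    and fin: "finite (sym_diff H1 H2)" and le: "sym_diff H1 H \<subseteq> sym_diff H2 H"
  shows "lattice (poset_interval (tope_poset E uminus (cone_in E) H) H1 H2)" (is "lattice ?L")
proof -
  have carrier: "F \<in> carrier ?L \<longleftrightarrow>
      half F \<and> sym_diff H1 H \<subseteq> sym_diff F H \<and> sym_diff F H \<subseteq> sym_diff H2 H" for F
    by (auto simp: poset_interval_def tope_poset_def at_least_at_most_def)
  have le_L: "F \<sqsubseteq>\<^bsub>?L\<^esub> G \<longleftrightarrow> sym_diff F H \<subseteq> sym_diff G H" for F G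
    by (simp add: poset_interval_def tope_poset_def)
  have eq_L: "eq ?L = (=)"
    by (simp add: poset_interval_def tope_poset_def)
  have up: "F \<sqsubseteq>\<^bsub>?L\<^esub> G \<longleftrightarrow> H1 - F \<subseteq> H1 - G" if "F \<in> carrier ?L" "G \<in> carrier ?L" for F G
    unfolding le_L using that by (intro sym_diff_le_iff_lower[OF H H1]) (simp_all add: carrier)
  have down: "F \<sqsubseteq>\<^bsub>?L\<^esub> G \<longleftrightarrow> H2 - G \<subseteq> H2 - F" if "F \<in> carrier ?L" "G \<in> carrier ?L" for F G
    unfolding le_L using that by (intro sym_diff_le_iff_upper[OF H H2]) (simp_all add: carrier)
  have H1L: "H1 \<in> carrier ?L" and H2L: "H2 \<in> carrier ?L"
    using H1 H2 le by (auto simp: carrier)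
  have H1_le: "H1 \<sqsubseteq>\<^bsub>?L\<^esub> F" and le_H2: "F \<sqsubseteq>\<^bsub>?L\<^esub> H2" if "F \<in> carrier ?L" for F
    using that unfolding carrier le_L by blast+
  have finite12: "finite (H1 - H2)" "finite (H2 - H1)"
    using fin by auto
  have po: "partial_order ?L"
  proof (unfold_locales, unfold eq_L le_L)
    \<comment> \<open>Antisymmetry: a hemispace is recovered from its symmetric difference with
      \<open>H\<close>.\<close>
    fix x y assume "sym_diff x H \<subseteq> sym_diff y H" "sym_diff y H \<subseteq> sym_diff x H"
    then show "x = y" by blast
  qed auto
  interpret partial_order ?L by (rule po)
  show ?thesis
  proof (unfold_locales)
    fix x y assume x: "x \<in> carrier ?L" and y: "y \<in> carrier ?L"
    have half: "half x" "half y" using x y by (auto simp: carrier)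
    have xy: "H1 - x \<subseteq> H1 - H2" "H1 - y \<subseteq> H1 - H2" using le_H2 x y H2L up by simp_all
    \<comment> \<open>Joins are taken with base \<open>H1\<close>, which also serves as the initial
      common lower bound \<open>z\<close>.\<close>
    obtain j where j: "half j" "H1 - x \<subseteq> H1 - j" "H1 - y \<subseteq> H1 - j" "H1 - j \<subseteq> H1 - H2"
      and j_least: "\<And>m. half m \<Longrightarrow> H1 - x \<subseteq> H1 - m \<Longrightarrow> H1 - y \<subseteq> H1 - m \<Longrightarrow> H1 - j \<subseteq> H1 - m"
      using join_exists_above[OF H1 H2 finite12(1) H1 _ _ half(1) xy(1) half(2) xy(2)]
      by (metis Diff_cancel empty_subsetI)
    have "sym_diff H1 H \<subseteq> sym_diff j H"
      by (rule sym_diff_between_lower[OF H H1 H2 j(1) le j(4)])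
    moreover from this have "sym_diff j H \<subseteq> sym_diff H2 H"
      using sym_diff_le_iff_lower[OF H H1 j(1) H2] le j(4) by blast
    ultimately have jL: "j \<in> carrier ?L" using j(1) by (simp add: carrier)
    have "least ?L j (Upper ?L {x, y})"
    proof (rule least_UpperI)
      show "v \<sqsubseteq>\<^bsub>?L\<^esub> j" if "v \<in> {x, y}" for v
        using that up[OF x jL] up[OF y jL] j(2,3) by blast
      show "j \<sqsubseteq>\<^bsub>?L\<^esub> m" if "m \<in> Upper ?L {x, y}" for m
      proof -
        have m: "m \<in> carrier ?L" "x \<sqsubseteq>\<^bsub>?L\<^esub> m" "y \<sqsubseteq>\<^bsub>?L\<^esub> m"
          using that x y by (auto simp only: Upper_def)
        have "half m" using m(1) unfolding carrier by (rule conjunct1)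
        then show ?thesis
          unfolding up[OF jL m(1)] by (rule j_least) (use m(2,3) up[OF x m(1)] up[OF y m(1)] in blast)+
      qed
    qed (use x y jL in blast)+
    then show "\<exists>s. least ?L s (Upper ?L {x, y})" ..
  next
    fix x y assume x: "x \<in> carrier ?L" and y: "y \<in> carrier ?L"
    have half: "half x" "half y" using x y by (auto simp: carrier)
    have xy: "H2 - x \<subseteq> H2 - H1" "H2 - y \<subseteq> H2 - H1" using H1_le x y H1L down by simp_all
    \<comment> \<open>Meets are joins for base \<open>H2\<close> and target \<open>H1\<close>, by
      the order reversal in \<open>down\<close>.\<close>
    obtain j where j: "half j" "H2 - x \<subseteq> H2 - j" "H2 - y \<subseteq> H2 - j" "H2 - j \<subseteq> H2 - H1"
      and j_greatest: "\<And>m. half m \<Longrightarrow> H2 - x \<subseteq> H2 - m \<Longrightarrow> H2 - y \<subseteq> H2 - m \<Longrightarrow> H2 - j \<subseteq> H2 - m"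
      using join_exists_above[OF H2 H1 finite12(2) H2 _ _ half(1) xy(1) half(2) xy(2)]
      by (metis Diff_cancel empty_subsetI)
    have "sym_diff j H \<subseteq> sym_diff H2 H"
      by (rule sym_diff_between_upper[OF H H1 H2 j(1) le j(4)])
    moreover from this have "sym_diff H1 H \<subseteq> sym_diff j H"
      using sym_diff_le_iff_upper[OF H H2 H1 j(1)] le j(4) by blast
    ultimately have jL: "j \<in> carrier ?L" using j(1) by (simp add: carrier)
    have "greatest ?L j (Lower ?L {x, y})"
    proof (rule greatest_LowerI)
      show "j \<sqsubseteq>\<^bsub>?L\<^esub> v" if "v \<in> {x, y}" for v
        using that down[OF jL x] down[OF jL y] j(2,3) by blast
      show "m \<sqsubseteq>\<^bsub>?L\<^esub> j" if "m \<in> Lower ?L {x, y}" for m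
      proof -
        have m: "m \<in> carrier ?L" "m \<sqsubseteq>\<^bsub>?L\<^esub> x" "m \<sqsubseteq>\<^bsub>?L\<^esub> y"
          using that x y by (auto simp only: Lower_def)
        have "half m" using m(1) unfolding carrier by (rule conjunct1)
        then show ?thesis
          unfolding down[OF m(1) jL]
          by (rule j_greatest) (use m(2,3) down[OF m(1) x] down[OF m(1) y] in blast)+
      qed
    qed (use x y jL in blast)+
    then show "\<exists>s. greatest ?L s (Lower ?L {x, y})" ..
  qed
qed

end

section \<open>The affine root system as a reflection configuration\<close>

lemma finite_root_system_uminus:
  assumes "finite_root_system \<Phi>" "\<alpha> \<in> \<Phi>"
  shows "- \<alpha> \<in> \<Phi>"
  using assms unfolding finite_root_system_def by blast

text \<open>At level 0 the hat contains only the positive roots and at each positive level all of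
  \<Phi>; negation adds the negative roots at level 0 and all negative levels.\<close>

lemma affine_roots_eq:
  fixes \<Phi> P :: "'a::euclidean_space set"
  assumes "finite_root_system \<Phi>" and "positive_system \<Phi> P"
  shows "affine_roots \<Phi> P = \<Phi> \<times> \<int>"
proof -
  obtain \<rho> where \<rho>: "\<forall>\<alpha>\<in>\<Phi>. \<rho> \<bullet> \<alpha> \<noteq> 0" and P: "P = {\<alpha> \<in> \<Phi>. \<rho> \<bullet> \<alpha> > 0}"
    using assms(2) by (auto simp: positive_system_def)
  have neg: "- \<alpha> \<in> \<Phi> \<longleftrightarrow> \<alpha> \<in> \<Phi>" for \<alpha>
    using finite_root_system_uminus[OF assms(1)] by (metis add.inverse_inverse)
  have uP: "\<alpha> \<in> uminus ` P \<longleftrightarrow> - \<alpha> \<in> P" for \<alpha>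
    by (metis add.inverse_inverse image_iff)
  have hat: "x \<in> affine_hat P \<Phi> \<longleftrightarrow> fst x \<in> \<Phi> \<and>
      (\<exists>n. fst x \<in> P \<and> snd x = real n \<or> - fst x \<in> P \<and> snd x = real (n + 1))" for x :: "'a \<times> real"
    unfolding affine_hat_def uP by (cases x) auto
  have um: "x \<in> uminus ` affine_hat P \<Phi> \<longleftrightarrow> - x \<in> affine_hat P \<Phi>" for x :: "'a \<times> real"
    by (metis add.inverse_inverse image_iff)
  have hat_sub: "affine_hat P \<Phi> \<subseteq> \<Phi> \<times> \<int>"
    unfolding affine_hat_def by auto
  show ?thesis
  proof (intro Set.set_eqI iffI)
    fix x :: "'a \<times> real" assume "x \<in> affine_roots \<Phi> P"
    then have "x \<in> \<Phi> \<times> \<int> \<or> - x \<in> \<Phi> \<times> \<int>"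
      using hat_sub by (auto simp: affine_roots_def um)
    then show "x \<in> \<Phi> \<times> \<int>" by (cases x) (auto simp: neg)
  next
    fix x :: "'a \<times> real" assume "x \<in> \<Phi> \<times> \<int>"
    then obtain \<alpha> k where x: "x = (\<alpha>, of_int k)" "\<alpha> \<in> \<Phi>" by (auto elim: Ints_cases)
    have P_or: "\<alpha> \<in> P \<or> - \<alpha> \<in> P"
      using \<rho> x(2) neg[of \<alpha>] by (auto simp: P neq_iff)
    \<comment> \<open>For nonnegative \<open>k\<close> the sign of \<alpha> matters only at
      \<open>k = 0\<close>, where a negative root is reached through \<open>- x\<close>. For
      negative \<open>k\<close>, \<open>- x\<close> has level at least 1 and lies in the hat for
      either sign.\<close>
    consider n where "k = int n" | n where "k = - int (n + 1)"
      by (cases k rule: int_cases) auto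
    then have "x \<in> affine_hat P \<Phi> \<or> - x \<in> affine_hat P \<Phi>"
    proof cases
      case (1 n)
      then show ?thesis
        using P_or x neg[of \<alpha>] unfolding hat by (cases n) (force intro: exI[of _ n])+
    next
      case (2 n)
      then have "snd (- x) = real (n + 1)" "fst (- x) = - \<alpha>" using x by auto
      then show ?thesis
        using P_or x neg[of \<alpha>] unfolding hat by (metis add.inverse_inverse)
    qed
    then show "x \<in> affine_roots \<Phi> P"
      by (simp add: affine_roots_def um)
  qed
qed

text \<open>The functional ignores the \<delta>-coordinate. The reflection in
  \<open>(\<alpha>, s)\<close> sends \<open>(\<beta>, t)\<close> to the reflected root at level
  \<open>t\<close> minus \<open>s\<close> times a Cartan integer, which is again an integer.\<close>

lemma affine_reflection_configuration:
  fixes \<Phi> :: "'a::euclidean_space set"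
  assumes root: "finite_root_system \<Phi>" and cry: "crystallographic \<Phi>"
  shows "reflection_configuration (\<Phi> \<times> (\<int> :: real set))
    (\<lambda>a b. 2 * (fst b \<bullet> fst a) / (fst a \<bullet> fst a))"
proof (intro reflection_configuration.intro vector_configuration.intro reflection_configuration_axioms.intro)
  have nz: "0 \<notin> \<Phi>" and line: "\<And>\<alpha>. \<alpha> \<in> \<Phi> \<Longrightarrow> \<Phi> \<inter> span {\<alpha>} = {\<alpha>, - \<alpha>}"
    and refl: "\<And>\<alpha> \<beta>. \<alpha> \<in> \<Phi> \<Longrightarrow> \<beta> \<in> \<Phi> \<Longrightarrow> root_reflection \<alpha> \<beta> \<in> \<Phi>"
    using root by (auto simp: finite_root_system_def)
  show "0 \<notin> \<Phi> \<times> (\<int> :: real set)" using nz by (simp add: zero_prod_def)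
  show "- x \<in> \<Phi> \<times> \<int>" if "x \<in> \<Phi> \<times> (\<int> :: real set)" for x
    using that finite_root_system_uminus[OF root] by (cases x) auto
  show "k = 1" if x: "x \<in> \<Phi> \<times> (\<int> :: real set)" "k *\<^sub>R x \<in> \<Phi> \<times> \<int>" and k: "k > 0" for x k
  proof -
    obtain \<alpha> where \<alpha>: "\<alpha> \<in> \<Phi>" "k *\<^sub>R \<alpha> \<in> \<Phi>" using x by (cases x) (auto simp: scaleR_prod_def)
    then have "k *\<^sub>R \<alpha> \<in> {\<alpha>, - \<alpha>}"
      unfolding line[OF \<alpha>(1), symmetric] by (auto simp: span_singleton)
    then have "(k - 1) *\<^sub>R \<alpha> = 0 \<or> (k + 1) *\<^sub>R \<alpha> = 0"
      by (auto simp: algebra_simps)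
    moreover have "\<alpha> \<noteq> 0" using \<alpha> nz by auto
    ultimately show ?thesis using k by auto
  qed
  show "linear (\<lambda>b. 2 * (fst b \<bullet> fst a) / (fst a \<bullet> fst a))" for a :: "'a \<times> real"
    by (rule linearI) (simp_all add: inner_add_left add_divide_distrib distrib_left)
  show "2 * (fst a \<bullet> fst a) / (fst a \<bullet> fst a) = 2" if "a \<in> \<Phi> \<times> (\<int> :: real set)" for a
    using that nz by (cases a) auto
  show "b - (2 * (fst b \<bullet> fst a) / (fst a \<bullet> fst a)) *\<^sub>R a \<in> \<Phi> \<times> \<int>"
    if mem: "a \<in> \<Phi> \<times> (\<int> :: real set)" "b \<in> \<Phi> \<times> \<int>" for a b
  proof -
    obtain \<alpha> s \<beta> t where ab: "a = (\<alpha>, s)" "b = (\<beta>, t)" "\<alpha> \<in> \<Phi>" "\<beta> \<in> \<Phi>" "s \<in> \<int>" "t \<in> \<int>"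
      using mem by (auto elim!: SigmaE)
    then have "2 * (\<beta> \<bullet> \<alpha>) / (\<alpha> \<bullet> \<alpha>) \<in> \<int>" using cry by (simp add: crystallographic_def)
    then show ?thesis
      using ab refl[OF ab(3,4)]
      by (auto simp: root_reflection_def simp del: times_divide_eq_left intro!: Ints_diff Ints_mult)
  qed
qed

theorem theorem7p2:
  fixes \<Phi> P :: "'a::euclidean_space set"
    and E H H1 H2 :: "('a \<times> real) set"
    and cx :: "('a \<times> real) set \<Rightarrow> ('a \<times> real) set"
  assumes "finite_root_system \<Phi>" and "crystallographic \<Phi>" and "irreducible_roots \<Phi>"
    and "positive_system \<Phi> P"
    and "E = affine_roots \<Phi> P" and "cx = cone_in E"
    and "hemispace E uminus cx H"
    and "hemispace E uminus cx H1" and "hemispace E uminus cx H2"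
    and "same_block H1 H2"
    and "H1 \<sqsubseteq>\<^bsub>tope_poset E uminus cx H\<^esub> H2"
  shows "lattice (poset_interval (tope_poset E uminus cx H) H1 H2)"
proof -
  have "E = \<Phi> \<times> \<int>" using affine_roots_eq assms by blast
  then interpret reflection_configuration E "\<lambda>a b. 2 * (fst b \<bullet> fst a) / (fst a \<bullet> fst a)"
    using affine_reflection_configuration assms by simp
  show ?thesis
    using assms lattice_tope_interval by (simp add: same_block_def tope_poset_def)
qed

end
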